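(* Let $p(\mathbf{x})$ be a polynomial with real coefficients in $\mathbf{x}=(x_1,\dots,x_m)\in\mathbb{R}^m$. Let $\mathbf{0}=(0,\dots,0)\in\mathbb{R}^m$ be a local minimum point of the polynomial $p(\mathbf{x})$, with $p(\mathbf{0})=0$. Suppose that $\mathbf{0}$ is simultaneously a local minimum point in the problem $$x_1\to\min;\quad p(\mathbf{x})=0 .$$ Then $\mathbf{0}$ is a local minimum point in the problem $$x_1\to\min;\quad \frac{\partial p(\mathbf{x})}{\partial x_i}=0,\ i=1,\dots,m .$$
   Context: A problem written "$f(\mathbf{x})\to\min;$ (constraints)" means minimizing $f$ over the feasible set $S\subseteq\mathbb{R}^m$ of all points satisfying the constraints. A local minimum point in this problem is a point $\mathbf{x}^*\in S$ for which there is a neighborhood $V$ of $\mathbf{x}^*$ in $\mathbb{R}^m$ with $f(\mathbf{x})\ge f(\mathbf{x}^* )$ for all $\mathbf{x}\in S\cap V$. A local minimum point of a polynomial $p$ is a local minimum point of the unconstrained problem ($S=\mathbb{R}^m$). *)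

theory Defs
  imports "HOL-Analysis.Analysis"
begin

definition local_min_on :: "'a::topological_space set \<Rightarrow> ('a \<Rightarrow> real) \<Rightarrow> 'a \<Rightarrow> bool" where
  "local_min_on S f x \<longleftrightarrow>
     x \<in> S \<and> (\<exists>V. open V \<and> x \<in> V \<and> (\<forall>y \<in> S \<inter> V. f y \<ge> f x))"

definition partial_deriv :: "(real ^ 'm \<Rightarrow> real) \<Rightarrow> 'm::finite \<Rightarrow> real ^ 'm \<Rightarrow> real" where
  "partial_deriv f i x = deriv (\<lambda>t. f (x + t *\<^sub>R axis i 1)) 0"

end

theory Submission
  imports Defs
begin

text \<open>
  The heart of the matter is that a real polynomial \<open>p\<close> takes only finitely many values on the set \<open>C\<close>
  of its critical points (\<open>finite_critical_values\<close>). Granting this, 0 has a neighbourhood in which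
  \<open>p\<close> takes no critical value other than possibly 0, so by continuity every critical point near the
  origin is a zero of \<open>p\<close>. Near the origin \<open>C\<close> is thus contained in the zero set, on which the
  coordinate function is minimal at the origin by assumption; and the origin lies in \<open>C\<close> because it
  is a local minimum of \<open>p\<close>.

  Finiteness of the critical values is proved algebraically. Suppose there were critical points
  \<open>x 0, x 1, \<dots>\<close> with pairwise distinct values. Computing with real sequences modulo a free ultrafilter
  yields a field \<open>K\<close> that extends the reals, a single point \<open>\<xi>\<close> with coordinates in \<open>K\<close> at which all
  partial derivatives of \<open>p\<close> vanish, and a value \<open>t = p(\<xi>)\<close> in \<open>K\<close>. As a nonzero real polynomial has
  finitely many roots and the values are distinct, \<open>t\<close> is transcendental over the reals
  (\<open>injective_seq_transcendental\<close>). Hence formal differentiation \<open>d/dt\<close> is a well-defined derivation of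
  the ring generated by the reals and \<open>t\<close>. In characteristic 0 a derivation of a subring of \<open>K\<close> with
  values in \<open>K\<close> extends to any further element (\<open>ex_compatible_value\<close>, \<open>extend_derivation\<close>), so
  there is a derivation \<open>D\<close> that kills the reals, has \<open>D t = 1\<close>, and is defined at all coordinates of
  \<open>\<xi>\<close>. The chain rule (\<open>derivation_of_polynomial_values\<close>) now gives
  \<open>1 = D(p(\<xi>)) = (\<Sum>i. \<partial>\<^sub>i p(\<xi>) D \<xi>\<^sub>i) = 0\<close>, which is absurd.
\<close>

section \<open>Free ultrafilters on the natural numbers\<close>

definition free_ultrafilter :: "'a filter \<Rightarrow> bool" where
  "free_ultrafilter U \<longleftrightarrow> U \<noteq> bot \<and> U \<le> cofinite \<and> (\<forall>P. eventually P U \<or> eventually (\<lambda>x. \<not> P x) U)"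

text \<open>
  By Zorn's lemma there is a minimal, i.e. finest, proper filter below the cofinite filter. If it does
  not contain the complement of \<open>P\<close>, adjoining \<open>P\<close> gives a proper filter, so by minimality \<open>P\<close> was
  already in it.
\<close>

lemma ex_free_ultrafilter: "\<exists>U :: nat filter. free_ultrafilter U"
proof -
  define \<F> where "\<F> = {F :: nat filter. F \<noteq> bot \<and> F \<le> cofinite}"
  have cof: "cofinite \<in> \<F>"
    by (simp add: \<F>_def)
  have po: "partial_order_on \<F> (relation_of (\<lambda>F G. G \<le> F) \<F>)"
    by (auto simp: partial_order_on_def preorder_on_def refl_on_def trans_def antisym_def relation_of_def)
  have "\<exists>B\<in>\<F>. \<forall>F\<in>\<C>. B \<le> F" if "\<C> \<in> Chains (relation_of (\<lambda>F G. G \<le> F) \<F>)" for \<C>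
  proof (cases "\<C> = {}")
    case True
    then show ?thesis
      using cof by blast
  next
    case False
    have sub: "\<C> \<subseteq> \<F>" and lin: "\<And>F G. F \<in> \<C> \<Longrightarrow> G \<in> \<C> \<Longrightarrow> F \<le> G \<or> G \<le> F"
      using that by (auto simp: Chains_def relation_of_def)
    have "eventually (\<lambda>_. False) (Inf \<C>) \<longleftrightarrow> (\<exists>F\<in>\<C>. eventually (\<lambda>_. False) F)"
      using False lin by (intro eventually_Inf_base) (metis inf.absorb1 inf.absorb2 order_refl)+
    then have "Inf \<C> \<noteq> bot"
      using sub by (auto simp: trivial_limit_def \<F>_def)
    moreover have "Inf \<C> \<le> cofinite"
      using False sub by (auto simp: \<F>_def intro: Inf_lower2)
    ultimately show ?thesis
      by (intro bexI[of _ "Inf \<C>"]) (auto simp: \<F>_def intro: Inf_lower)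
  qed
  then obtain U where U: "U \<in> \<F>" and max: "\<And>F. F \<in> \<F> \<Longrightarrow> F \<le> U \<Longrightarrow> F = U"
    using predicate_Zorn[OF po] by blast
  have "eventually P U" if "\<not> eventually (\<lambda>x. \<not> P x) U" for P
  proof -
    have "inf U (principal (Collect P)) \<in> \<F>"
      using U that by (auto simp: \<F>_def trivial_limit_def eventually_inf_principal intro: le_infI1)
    then have "inf U (principal (Collect P)) = U"
      by (intro max) auto
    moreover have "eventually P (inf U (principal (Collect P)))"
      by (simp add: eventually_inf_principal)
    ultimately show ?thesis
      by simp
  qed
  then show ?thesis
    using U by (auto simp: free_ultrafilter_def \<F>_def)
qed

definition ultra :: "nat filter" where
  "ultra = (SOME U. free_ultrafilter U)"

lemma free_ultrafilter_ultra: "free_ultrafilter ultra"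
  unfolding ultra_def using ex_free_ultrafilter by (rule someI_ex)

lemma ultra_not_bot [simp]: "ultra \<noteq> bot"
  and ultra_le_cofinite: "ultra \<le> cofinite"
  and not_eventually_ultra: "\<not> eventually P ultra \<Longrightarrow> eventually (\<lambda>n. \<not> P n) ultra"
  using free_ultrafilter_ultra by (auto simp: free_ultrafilter_def)

section \<open>The ultrapower of the reals\<close>

quotient_type ultrareal = "nat \<Rightarrow> real" / "\<lambda>f g. eventually (\<lambda>n. f n = g n) ultra"
proof (rule equivpI)
  show "transp (\<lambda>f g :: nat \<Rightarrow> real. eventually (\<lambda>n. f n = g n) ultra)"
    by (rule transpI) (erule (1) eventually_elim2, simp)
qed (auto simp: reflp_def symp_def eq_commute)

instantiation ultrareal :: field
begin

lift_definition zero_ultrareal :: ultrareal is "\<lambda>_. 0" .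
lift_definition one_ultrareal :: ultrareal is "\<lambda>_. 1" .
lift_definition plus_ultrareal :: "ultrareal \<Rightarrow> ultrareal \<Rightarrow> ultrareal" is "\<lambda>f g n. f n + g n"
  by (erule (1) eventually_elim2) simp
lift_definition minus_ultrareal :: "ultrareal \<Rightarrow> ultrareal \<Rightarrow> ultrareal" is "\<lambda>f g n. f n - g n"
  by (erule (1) eventually_elim2) simp
lift_definition times_ultrareal :: "ultrareal \<Rightarrow> ultrareal \<Rightarrow> ultrareal" is "\<lambda>f g n. f n * g n"
  by (erule (1) eventually_elim2) simp
lift_definition divide_ultrareal :: "ultrareal \<Rightarrow> ultrareal \<Rightarrow> ultrareal" is "\<lambda>f g n. f n / g n"
  by (erule (1) eventually_elim2) simp
lift_definition uminus_ultrareal :: "ultrareal \<Rightarrow> ultrareal" is "\<lambda>f n. - f n"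
  by (erule eventually_mono) simp
lift_definition inverse_ultrareal :: "ultrareal \<Rightarrow> ultrareal" is "\<lambda>f n. inverse (f n)"
  by (erule eventually_mono) simp

instance
proof
  fix a :: ultrareal
  show "a \<noteq> 0 \<Longrightarrow> inverse a * a = 1"
    by transfer (auto dest!: not_eventually_ultra elim!: eventually_mono)
  show "(0::ultrareal) \<noteq> 1"
    by transfer simp
qed (transfer; simp add: algebra_simps divide_inverse)+

end

lift_definition seq_class :: "(nat \<Rightarrow> real) \<Rightarrow> ultrareal" is "\<lambda>f. f" .

lemma seq_class_eq_iff: "seq_class f = seq_class g \<longleftrightarrow> eventually (\<lambda>n. f n = g n) ultra"
  by transfer simp

lemma seq_class_eq_0_iff: "seq_class f = 0 \<longleftrightarrow> eventually (\<lambda>n. f n = 0) ultra"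
  by transfer simp

lemma seq_class_add: "seq_class (\<lambda>n. f n + g n) = seq_class f + seq_class g"
  and seq_class_diff: "seq_class (\<lambda>n. f n - g n) = seq_class f - seq_class g"
  and seq_class_mult: "seq_class (\<lambda>n. f n * g n) = seq_class f * seq_class g"
  and seq_class_0: "seq_class (\<lambda>n. 0) = 0"
  and seq_class_1: "seq_class (\<lambda>n. 1) = 1"
  by (transfer, simp)+

lemma seq_class_sum: "seq_class (\<lambda>n. \<Sum>i\<in>A. f i n) = (\<Sum>i\<in>A. seq_class (f i))"
  by (induction A rule: infinite_finite_induct) (simp_all add: seq_class_0 seq_class_add)

text \<open>The ultrapower inherits characteristic 0 from the reals, as numerals are classes of constant sequences.\<close>

lemma of_nat_ultrareal: "of_nat k = seq_class (\<lambda>_. of_nat k)"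
  by (induction k) (simp_all add: seq_class_0 seq_class_add seq_class_1)

instance ultrareal :: field_char_0
  by standard (simp add: inj_on_def of_nat_ultrareal seq_class_eq_iff)

section \<open>Extending derivations\<close>

text \<open>
  The predicate includes that \<open>F\<close> is a subring. The values of \<open>D\<close> may lie outside \<open>F\<close>: extending \<open>D\<close> to
  an algebraic element involves a division, and leaving the codomain free lets one work with subrings
  throughout instead of passing to subfields.
\<close>

definition partial_derivation :: "'a::comm_ring_1 set \<Rightarrow> ('a \<Rightarrow> 'a) \<Rightarrow> bool" where
  "partial_derivation F D \<longleftrightarrow> 1 \<in> F \<and>
     (\<forall>x\<in>F. \<forall>y\<in>F. x - y \<in> F \<and> x * y \<in> F \<and> D (x - y) = D x - D y \<and> D (x * y) = x * D y + D x * y)"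

lemma partial_derivationD:
  assumes "partial_derivation F D"
  shows partial_derivation_1: "1 \<in> F"
    and partial_derivation_0: "0 \<in> F" "D 0 = 0"
    and partial_derivation_diff: "x \<in> F \<Longrightarrow> y \<in> F \<Longrightarrow> x - y \<in> F" "x \<in> F \<Longrightarrow> y \<in> F \<Longrightarrow> D (x - y) = D x - D y"
    and partial_derivation_mult: "x \<in> F \<Longrightarrow> y \<in> F \<Longrightarrow> x * y \<in> F"
      "x \<in> F \<Longrightarrow> y \<in> F \<Longrightarrow> D (x * y) = x * D y + D x * y"
    and partial_derivation_add: "x \<in> F \<Longrightarrow> y \<in> F \<Longrightarrow> x + y \<in> F" "x \<in> F \<Longrightarrow> y \<in> F \<Longrightarrow> D (x + y) = D x + D y"
proof -
  have diff: "x - y \<in> F \<and> D (x - y) = D x - D y" if "x \<in> F" "y \<in> F" for x y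
    using assms that by (auto simp: partial_derivation_def)
  show one: "1 \<in> F"
    using assms by (simp add: partial_derivation_def)
  show zero: "0 \<in> F" "D 0 = 0"
    using diff[OF one one] by auto
  show "x + y \<in> F" "D (x + y) = D x + D y" if "x \<in> F" "y \<in> F"
    using diff[OF zero(1) that(2)] diff[OF that(1), of "0 - y"] zero(2) by auto
qed (use assms in \<open>auto simp: partial_derivation_def\<close>)

lemma partial_derivation_1_eq_0: "partial_derivation F D \<Longrightarrow> D 1 = 0"
  using partial_derivation_mult(2)[of F D 1 1] partial_derivation_1[of F D] by auto

lemma partial_derivation_sum:
  assumes "partial_derivation F D" "\<And>i. i \<in> A \<Longrightarrow> f i \<in> F"
  shows "sum f A \<in> F" "D (sum f A) = (\<Sum>i\<in>A. D (f i))"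
  using assms(2)
  by (induction A rule: infinite_finite_induct)
     (auto simp: partial_derivationD[OF assms(1)])

definition polys_over :: "'a::zero set \<Rightarrow> 'a poly set" where
  "polys_over F = {f. \<forall>i. coeff f i \<in> F}"

text \<open>
  The value \<open>f\<^sup>D(a) + f'(a) u\<close>, where \<open>f\<^sup>D\<close> arises from \<open>f\<close> by applying \<open>D\<close> to the coefficients. It is what
  an extension of \<open>D\<close> with \<open>D a = u\<close> has to assign to \<open>f(a)\<close>.
\<close>

definition total_derivative :: "('a::idom \<Rightarrow> 'a) \<Rightarrow> 'a \<Rightarrow> 'a \<Rightarrow> 'a poly \<Rightarrow> 'a" where
  "total_derivative D a u f = poly (map_poly D f) a + poly (pderiv f) a * u"

context
  fixes F :: "'a::idom set" and D :: "'a \<Rightarrow> 'a"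
  assumes D: "partial_derivation F D"
begin

lemma const_in_polys_over: "c \<in> F \<Longrightarrow> [:c:] \<in> polys_over F"
  by (auto simp: polys_over_def coeff_pCons partial_derivation_0[OF D] split: nat.split)

lemma monom_in_polys_over: "c \<in> F \<Longrightarrow> monom c k \<in> polys_over F"
  by (auto simp: polys_over_def partial_derivation_0[OF D])

lemma polys_over_diff: "f \<in> polys_over F \<Longrightarrow> g \<in> polys_over F \<Longrightarrow> f - g \<in> polys_over F"
  by (auto simp: polys_over_def partial_derivation_diff[OF D])

lemma polys_over_mult: "f \<in> polys_over F \<Longrightarrow> g \<in> polys_over F \<Longrightarrow> f * g \<in> polys_over F"
  by (auto simp: polys_over_def coeff_mult
      intro!: partial_derivation_sum[OF D] partial_derivation_mult[OF D])

lemma total_derivative_diff: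
  assumes "f \<in> polys_over F" "g \<in> polys_over F"
  shows "total_derivative D a u (f - g) = total_derivative D a u f - total_derivative D a u g"
proof -
  have "map_poly D (f - g) = map_poly D f - map_poly D g"
    using assms by (intro poly_eqI)
      (auto simp: coeff_map_poly polys_over_def partial_derivation_0[OF D] partial_derivation_diff[OF D])
  then show ?thesis
    unfolding total_derivative_def by (simp add: pderiv_diff left_diff_distrib)
qed

lemma total_derivative_mult:
  assumes "f \<in> polys_over F" "g \<in> polys_over F"
  shows "total_derivative D a u (f * g) = poly f a * total_derivative D a u g + total_derivative D a u f * poly g a"
proof -
  have "map_poly D (f * g) = f * map_poly D g + map_poly D f * g"
  proof (rule poly_eqI)
    fix n
    have F: "coeff f i \<in> F" "coeff g i \<in> F" for i
      using assms by (auto simp: polys_over_def)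
    have "coeff (map_poly D (f * g)) n = (\<Sum>i\<le>n. D (coeff f i * coeff g (n - i)))"
      by (simp add: coeff_map_poly coeff_mult F partial_derivation_0[OF D] partial_derivation_mult[OF D]
          partial_derivation_sum[OF D])
    also have "\<dots> = coeff (f * map_poly D g + map_poly D f * g) n"
      by (simp add: coeff_map_poly coeff_mult F partial_derivation_0[OF D] partial_derivation_mult[OF D]
          sum.distrib)
    finally show "coeff (map_poly D (f * g)) n = coeff (f * map_poly D g + map_poly D f * g) n" .
  qed
  then show ?thesis
    by (simp add: total_derivative_def pderiv_mult algebra_simps)
qed

lemma total_derivative_const: "c \<in> F \<Longrightarrow> total_derivative D a u [:c:] = D c"
  by (simp add: total_derivative_def map_poly_pCons partial_derivation_0[OF D] pderiv_pCons)

text \<open>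
  An element of \<open>F[a]\<close> may be represented by several polynomials in \<open>a\<close>. The hypothesis on \<open>u\<close> says that
  the forced value of the extension does not depend on this choice; that the extension is a
  derivation is then inherited from the sum and product rules of the total derivative.
\<close>

lemma extend_derivation:
  assumes ker: "\<And>f. f \<in> polys_over F \<Longrightarrow> poly f a = 0 \<Longrightarrow> total_derivative D a u f = 0"
  obtains F' D' where "partial_derivation F' D'" "F \<subseteq> F'" "a \<in> F'" "\<And>x. x \<in> F \<Longrightarrow> D' x = D x" "D' a = u"
proof -
  define F' where "F' = (\<lambda>f. poly f a) ` polys_over F"
  define D' where "D' y = total_derivative D a u (SOME f. f \<in> polys_over F \<and> poly f a = y)" for y
  have D': "D' (poly f a) = total_derivative D a u f" if f: "f \<in> polys_over F" for f
  proof -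
    define g where "g = (SOME g. g \<in> polys_over F \<and> poly g a = poly f a)"
    have "g \<in> polys_over F \<and> poly g a = poly f a"
      unfolding g_def by (rule someI[of _ f]) (simp add: f)
    then have "total_derivative D a u (g - f) = 0" "g \<in> polys_over F"
      by (auto intro!: ker polys_over_diff f)
    then show ?thesis
      by (simp add: D'_def flip: g_def) (simp add: total_derivative_diff f)
  qed
  have "partial_derivation F' D'"
    unfolding partial_derivation_def
  proof (intro conjI ballI)
    show "1 \<in> F'"
      unfolding F'_def by (rule image_eqI[of _ _ "[:1:]"])
        (auto intro: const_in_polys_over partial_derivation_1[OF D])
    fix x y assume "x \<in> F'" "y \<in> F'"
    then obtain f g where f: "f \<in> polys_over F" "x = poly f a" and g: "g \<in> polys_over F" "y = poly g a"
      by (auto simp: F'_def)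
    have diff: "x - y = poly (f - g) a" and mult: "x * y = poly (f * g) a"
      by (simp_all add: f g)
    show "x - y \<in> F'" "x * y \<in> F'"
      unfolding diff mult F'_def using f g
      by (auto intro!: imageI polys_over_diff polys_over_mult simp del: poly_diff poly_mult)
    show "D' (x - y) = D' x - D' y"
      unfolding diff using f g by (simp add: D' polys_over_diff total_derivative_diff del: poly_diff)
    show "D' (x * y) = x * D' y + D' x * y"
      unfolding mult using f g by (simp add: D' polys_over_mult total_derivative_mult del: poly_mult)
  qed
  moreover have const: "c \<in> F' \<and> D' c = D c" if "c \<in> F" for c
    using D'[of "[:c:]"] that
    by (auto simp: F'_def const_in_polys_over total_derivative_const intro!: image_eqI[of _ _ "[:c:]"])
  moreover have X: "[:0, 1:] \<in> polys_over F"
    using monom_in_polys_over[OF partial_derivation_1[OF D], of 1] by (simp add: monom_altdef)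
  then have "a \<in> F' \<and> D' a = u"
    using D'[OF X]
    by (auto simp: F'_def total_derivative_def map_poly_pCons pderiv_pCons partial_derivation_0[OF D]
        partial_derivation_1_eq_0[OF D] intro!: image_eqI[of _ _ "[:0, 1:]"])
  ultimately show thesis
    using that by blast
qed

end

text \<open>
  If \<open>a\<close> is transcendental over \<open>F\<close>, there is nothing to satisfy. Otherwise let \<open>\<mu>\<close> be a nonzero polynomial of
  minimal degree that annihilates \<open>a\<close>. By minimality and characteristic 0, \<open>\<mu>'(a) \<noteq> 0\<close>, so the condition
  for \<open>\<mu>\<close> can be solved for \<open>u\<close>. It carries over to every other annihilating \<open>f\<close> by induction on the
  degree: one step of pseudo-division by \<open>\<mu>\<close>, which needs no inverses in \<open>F\<close>, lowers the degree of \<open>f\<close>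
  and multiplies its total derivative at \<open>a\<close> only by the leading coefficient of \<open>\<mu>\<close>.
\<close>

lemma ex_compatible_value:
  fixes F :: "'a::field_char_0 set"
  assumes D: "partial_derivation F D"
  shows "\<exists>u. \<forall>f\<in>polys_over F. poly f a = 0 \<longrightarrow> total_derivative D a u f = 0"
proof (cases "\<exists>f\<in>polys_over F. f \<noteq> 0 \<and> poly f a = 0")
  case False
  then have "total_derivative D a 0 f = 0" if "f \<in> polys_over F" "poly f a = 0" for f
    using that by (auto simp: total_derivative_def)
  then show ?thesis
    by blast
next
  case True
  define annihilates where "annihilates f \<longleftrightarrow> f \<in> polys_over F \<and> f \<noteq> 0 \<and> poly f a = 0" for f
  define \<mu> where "\<mu> = arg_min degree annihilates"
  obtain f0 where "annihilates f0"
    using True by (auto simp: annihilates_def)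
  then have \<mu>: "annihilates \<mu>" and min: "\<And>f. annihilates f \<Longrightarrow> degree \<mu> \<le> degree f"
    unfolding \<mu>_def by (auto intro: arg_min_natI arg_min_nat_le)
  have deg: "degree \<mu> \<noteq> 0"
  proof
    assume "degree \<mu> = 0"
    then obtain c where "\<mu> = [:c:]"
      by (rule degree_eq_zeroE)
    then show False
      using \<mu> by (simp add: annihilates_def)
  qed
  have "poly (pderiv \<mu>) a \<noteq> 0"
  proof
    assume root: "poly (pderiv \<mu>) a = 0"
    have "of_nat k \<in> F" for k
      by (induction k) (auto simp: partial_derivationD[OF D])
    then have "pderiv \<mu> \<in> polys_over F"
      using \<mu> partial_derivation_mult(1)[OF D, of "1 + of_nat k" for k]
        partial_derivation_add(1)[OF D partial_derivation_1[OF D]]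
      by (auto simp: polys_over_def annihilates_def coeff_pderiv)
    moreover have "pderiv \<mu> \<noteq> 0"
      using deg by (simp add: pderiv_eq_0_iff)
    ultimately have "degree \<mu> \<le> degree (pderiv \<mu>)"
      using root min by (simp add: annihilates_def)
    then show False
      using deg by (simp add: degree_pderiv)
  qed
  then obtain u where u: "total_derivative D a u \<mu> = 0"
    using that[of "- poly (map_poly D \<mu>) a / poly (pderiv \<mu>) a"] by (auto simp: total_derivative_def)
  have "total_derivative D a u f = 0" if "f \<in> polys_over F" "poly f a = 0" for f
    using that
  proof (induction "degree f" arbitrary: f rule: less_induct)
    case less
    show ?case
    proof (cases "f = 0")
      case True
      then show ?thesis
        by (simp add: total_derivative_def)
    next
      case False
      define k where "k = degree f - degree \<mu>"
      have k: "degree f = degree \<mu> + k"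
        using min[of f] less.prems False by (simp add: k_def annihilates_def)
      have lc: "lead_coeff \<mu> \<in> F" "lead_coeff f \<in> F"
        using \<mu> less.prems by (auto simp: annihilates_def polys_over_def)
      \<comment> \<open>\<open>A - B\<close> is the pseudo-division step: both terms have degree at most \<open>degree f\<close>, and the
        coefficients in that degree cancel.\<close>
      define A where "A = [:lead_coeff \<mu>:] * f"
      define B where "B = monom (lead_coeff f) k * \<mu>"
      note over = polys_over_mult[OF D] polys_over_diff[OF D] monom_in_polys_over[OF D] const_in_polys_over[OF D]
      have AB: "A \<in> polys_over F" "B \<in> polys_over F"
        using \<mu> less.prems lc by (auto simp: A_def B_def annihilates_def simp del: mult_pCons_left intro!: over)
      have h_root: "poly (A - B) a = 0"
        using \<mu> less.prems by (simp add: A_def B_def annihilates_def)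
      have h_over: "A - B \<in> polys_over F"
        using AB by (rule over)
      have "total_derivative D a u (A - B) = 0"
      proof (cases "A = B")
        case True
        then show ?thesis
          by (simp add: total_derivative_def)
      next
        case neq: False
        have "degree (A - B) \<le> degree f"
          using k by (intro degree_diff_le) (auto simp: A_def B_def intro!: order_trans[OF degree_mult_le] degree_monom_le
              order_trans[OF add_right_mono[OF degree_monom_le]])
        moreover have "coeff (A - B) (degree f) = 0"
          by (simp add: A_def B_def coeff_monom_mult k)
        ultimately have "degree (A - B) < degree f"
          using neq by (metis eq_iff_diff_eq_0 le_neq_implies_less leading_coeff_0_iff)
        then show ?thesis
          using less.hyps h_over h_root by blast
      qed
      then have "total_derivative D a u A = total_derivative D a u B"
        using AB by (simp add: total_derivative_diff[OF D])
      moreover have "total_derivative D a u A = lead_coeff \<mu> * total_derivative D a u f"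
        using less.prems lc unfolding A_def by (subst total_derivative_mult[OF D]) (auto intro: over)
      moreover have "total_derivative D a u B = 0"
        using \<mu> u lc unfolding B_def by (subst total_derivative_mult[OF D]) (auto simp: annihilates_def intro: over)
      moreover have "lead_coeff \<mu> \<noteq> 0"
        using \<mu> by (simp add: annihilates_def)
      ultimately show ?thesis
        by simp
    qed
  qed
  then show ?thesis
    by blast
qed

lemma extend_derivation_finite:
  fixes F :: "'a::field_char_0 set"
  assumes "finite A" "partial_derivation F D"
  shows "\<exists>F' D'. partial_derivation F' D' \<and> F \<union> A \<subseteq> F' \<and> (\<forall>x\<in>F. D' x = D x)"
  using assms(1)
proof (induction A)
  case empty
  then show ?case
    using assms(2) by auto
next
  case (insert a A)
  then obtain F1 D1 where 1: "partial_derivation F1 D1" "F \<union> A \<subseteq> F1" "\<forall>x\<in>F. D1 x = D x"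
    by blast
  obtain u where "\<And>f. f \<in> polys_over F1 \<Longrightarrow> poly f a = 0 \<Longrightarrow> total_derivative D1 a u f = 0"
    using ex_compatible_value[OF 1(1)] by blast
  then obtain F' D' where "partial_derivation F' D'" "F1 \<subseteq> F'" "a \<in> F'" "\<And>x. x \<in> F1 \<Longrightarrow> D' x = D1 x"
    using extend_derivation[OF 1(1)] by metis
  then show ?case
    using 1 by (intro exI[of _ F'] exI[of _ D']) auto
qed

section \<open>Derivations of the ultrapower and polynomial functions\<close>

definition standard_reals :: "ultrareal set" where
  "standard_reals = range (\<lambda>c. seq_class (\<lambda>_. c))"

lemma derivation_on_standard_reals: "partial_derivation standard_reals (\<lambda>_. 0)"
  unfolding partial_derivation_def standard_reals_def
  by (auto simp flip: seq_class_diff seq_class_mult seq_class_1)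

text \<open>
  A relation \<open>f(s) = 0\<close> over the standard reals means that a real polynomial vanishes at \<open>s n\<close> for
  ultrafilter-many \<open>n\<close>. A nonzero polynomial has finitely many roots, which an injective sequence hits
  only finitely often, and no finite set belongs to a free ultrafilter.
\<close>

lemma injective_seq_transcendental:
  assumes "inj s" "f \<in> polys_over standard_reals" "poly f (seq_class s) = 0"
  shows "f = 0"
proof -
  obtain c where c: "\<And>i. coeff f i = seq_class (\<lambda>_. c i)"
    using assms(2) unfolding polys_over_def standard_reals_def image_def by auto metis
  define q where "q = (\<Sum>i\<le>degree f. monom (c i) i)"
  have power: "seq_class s ^ i = seq_class (\<lambda>n. s n ^ i)" for i
    by (induction i) (simp_all add: seq_class_1 seq_class_mult)
  have "poly f (seq_class s) = seq_class (\<lambda>n. poly q (s n))"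
    by (simp add: poly_altdef[of f] q_def poly_sum poly_monom seq_class_sum seq_class_mult c power)
  then have ev: "eventually (\<lambda>n. poly q (s n) = 0) ultra"
    using assms(3) by (simp add: seq_class_eq_0_iff)
  have "q = 0"
  proof (rule ccontr)
    assume "q \<noteq> 0"
    then have "finite (s -` {x. poly q x = 0})"
      using assms(1) by (intro finite_vimageI poly_roots_finite)
    then have "eventually (\<lambda>n. poly q (s n) \<noteq> 0) cofinite"
      by (simp add: eventually_cofinite vimage_def)
    then have "eventually (\<lambda>n. poly q (s n) \<noteq> 0) ultra"
      using ultra_le_cofinite by (simp add: le_filter_def)
    with ev have "eventually (\<lambda>_. False) ultra"
      by (rule eventually_elim2) simp
    then show False
      by simp
  qed
  then have "c i = 0" if "i \<le> degree f" for i
    using that coeff_sum[of "\<lambda>i. monom (c i) i" "{..degree f}" i] by (simp add: q_def)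
  then have "lead_coeff f = 0"
    by (simp add: c seq_class_0)
  then show ?thesis
    by simp
qed

lemma DERIV_partial_deriv:
  assumes "real_polynomial_function f"
  shows "((\<lambda>t. f (x + t *\<^sub>R axis i 1)) has_real_derivative partial_deriv f i x) (at 0)"
proof -
  have "f differentiable at (x + 0 *\<^sub>R axis i 1)"
    using assms by (simp add: differentiable_at_real_polynomial_function)
  then have "(\<lambda>t. f (x + t *\<^sub>R axis i 1)) differentiable at 0"
    using differentiable_chain_at[of "\<lambda>t::real. x + t *\<^sub>R axis i 1" 0 f] by (simp add: o_def)
  then show ?thesis
    by (simp add: partial_deriv_def DERIV_deriv_iff_real_differentiable)
qed

text \<open>
  The chain rule for an algebraic derivation \<open>D\<close> that vanishes on the standard reals, with the analytic
  partial derivatives of \<open>f\<close>. Both sides obey the same sum and product rules in \<open>f\<close>, so it suffices to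
  compare them on linear and constant functions.
\<close>

lemma derivation_of_polynomial_values:
  fixes x :: "nat \<Rightarrow> real ^ 'm::finite"
  assumes f: "real_polynomial_function f" and D: "partial_derivation F D"
    and standard_reals: "standard_reals \<subseteq> F" "\<And>c. c \<in> standard_reals \<Longrightarrow> D c = 0"
    and coords: "\<And>i. seq_class (\<lambda>n. x n $ i) \<in> F"
  shows "seq_class (\<lambda>n. f (x n)) \<in> F \<and>
    D (seq_class (\<lambda>n. f (x n))) =
      (\<Sum>i\<in>UNIV. seq_class (\<lambda>n. partial_deriv f i (x n)) * D (seq_class (\<lambda>n. x n $ i)))"
  using f
proof (induction f rule: real_polynomial_function.induct)
  case (linear f)
  then interpret f: bounded_linear f .
  have const: "seq_class (\<lambda>_. c) \<in> F" "D (seq_class (\<lambda>_. c)) = 0" for c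
    using standard_reals by (auto simp: standard_reals_def)
  have part: "partial_deriv f i y = f (axis i 1)" for i y
    unfolding partial_deriv_def
    by (rule DERIV_imp_deriv) (auto simp: f.add f.scaleR intro!: derivative_eq_intros)
  have expand: "f y = (\<Sum>i\<in>UNIV. y $ i * f (axis i 1))" for y
  proof -
    have "f y = f (\<Sum>i\<in>UNIV. y $ i *\<^sub>R axis i 1)"
      using basis_expansion[of y] by (simp add: scalar_mult_eq_scaleR)
    then show ?thesis
      by (simp add: f.sum f.scaleR)
  qed
  have "seq_class (\<lambda>n. f (x n)) = seq_class (\<lambda>n. \<Sum>i\<in>UNIV. x n $ i * f (axis i 1))"
    by (intro arg_cong[of _ _ seq_class] ext expand)
  then have "seq_class (\<lambda>n. f (x n)) = (\<Sum>i\<in>UNIV. seq_class (\<lambda>n. x n $ i) * seq_class (\<lambda>_. f (axis i 1)))"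
    by (simp add: seq_class_sum seq_class_mult)
  then show ?case
    by (simp add: part coords const partial_derivation_sum[OF D] partial_derivation_mult[OF D] mult.commute)
next
  case (const c)
  have "partial_deriv (\<lambda>_. c) i y = 0" for i :: 'm and y
    by (simp add: partial_deriv_def)
  then show ?case
    using standard_reals by (auto simp: standard_reals_def seq_class_0)
next
  case (add f g)
  have "partial_deriv (\<lambda>x. f x + g x) i y = partial_deriv f i y + partial_deriv g i y" for i y
    unfolding partial_deriv_def[of "\<lambda>x. f x + g x"]
    by (rule DERIV_imp_deriv) (intro DERIV_add DERIV_partial_deriv add.hyps)
  then show ?case
    using add.IH
    by (simp add: seq_class_add partial_derivation_add[OF D] sum.distrib algebra_simps)
next
  case (mult f g)
  have "partial_deriv (\<lambda>x. f x * g x) i y = f y * partial_deriv g i y + partial_deriv f i y * g y" for i y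
    unfolding partial_deriv_def[of "\<lambda>x. f x * g x"]
    by (rule DERIV_imp_deriv)
       (use DERIV_mult[OF DERIV_partial_deriv[OF mult.hyps(1)] DERIV_partial_deriv[OF mult.hyps(2)]]
        in \<open>simp add: algebra_simps\<close>)
  then show ?case
    using mult.IH
    by (simp add: seq_class_add seq_class_mult partial_derivation_mult[OF D] sum.distrib
        sum_distrib_left algebra_simps)
qed

section \<open>Critical values of polynomials\<close>

text \<open>
  An injective sequence of critical values represents a transcendental element \<open>t\<close> of the ultrapower, which
  admits a derivation with \<open>D t = 1\<close>. The chain rule at the critical points forces \<open>D t = 0\<close>.
\<close>

lemma finite_critical_values:
  fixes p :: "real ^ 'm::finite \<Rightarrow> real"
  assumes p: "real_polynomial_function p"
  shows "finite (p ` {x. \<forall>i. partial_deriv p i x = 0})"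
proof (rule ccontr)
  assume "infinite (p ` {x. \<forall>i. partial_deriv p i x = 0})"
  then obtain s :: "nat \<Rightarrow> real" where s: "inj s" "range s \<subseteq> p ` {x. \<forall>i. partial_deriv p i x = 0}"
    using infinite_countable_subset by blast
  then have "\<forall>n. \<exists>x. (\<forall>i. partial_deriv p i x = 0) \<and> s n = p x"
    by auto
  then obtain x where crit: "\<And>n i. partial_deriv p i (x n) = 0" and s_eq: "\<And>n. s n = p (x n)"
    by metis
  \<comment> \<open>By transcendence, any value may be prescribed for the derivation at \<open>seq_class s\<close>; here it is 1.\<close>
  have "total_derivative (\<lambda>_. 0) (seq_class s) 1 f = 0"
    if "f \<in> polys_over standard_reals" "poly f (seq_class s) = 0" for f
    using injective_seq_transcendental[OF s(1) that] by (simp add: total_derivative_def)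
  then obtain F0 D0 where 0: "partial_derivation F0 D0" "standard_reals \<subseteq> F0" "seq_class s \<in> F0"
      "\<And>c. c \<in> standard_reals \<Longrightarrow> D0 c = 0" "D0 (seq_class s) = 1"
    using extend_derivation[OF derivation_on_standard_reals, of "seq_class s" 1] by metis
  obtain F D where FD: "partial_derivation F D" "F0 \<union> range (\<lambda>i. seq_class (\<lambda>n. x n $ i)) \<subseteq> F"
      "\<forall>y\<in>F0. D y = D0 y"
    using extend_derivation_finite[OF _ 0(1), of "range (\<lambda>i. seq_class (\<lambda>n. x n $ i))"] by auto
  have "D (seq_class (\<lambda>n. p (x n))) =
      (\<Sum>i\<in>UNIV. seq_class (\<lambda>n. partial_deriv p i (x n)) * D (seq_class (\<lambda>n. x n $ i)))"
    using 0 FD by (intro derivation_of_polynomial_values[THEN conjunct2, OF p FD(1)]) auto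
  then have "D (seq_class s) = 0"
    by (simp add: crit seq_class_0 flip: s_eq)
  then show False
    using 0 FD by simp
qed

lemma local_min_imp_critical:
  fixes p :: "real ^ 'm::finite \<Rightarrow> real"
  assumes p: "real_polynomial_function p" and min: "local_min_on UNIV p x"
  shows "partial_deriv p i x = 0"
proof -
  obtain V where V: "open V" "x \<in> V" "\<And>y. y \<in> V \<Longrightarrow> p x \<le> p y"
    using min by (auto simp: local_min_on_def)
  then obtain d where d: "d > 0" "ball x d \<subseteq> V"
    by (meson open_contains_ball)
  have "\<forall>t. \<bar>0 - t\<bar> < d \<longrightarrow> p (x + 0 *\<^sub>R axis i 1) \<le> p (x + t *\<^sub>R axis i 1)"
    using V(3) d(2) by (auto simp: dist_norm subset_iff)
  then show ?thesis
    using DERIV_local_min[OF DERIV_partial_deriv[OF p] d(1)] by blast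
qed

theorem theorem1:
  fixes p :: "real ^ 'm::finite \<Rightarrow> real" and k :: 'm
  assumes "real_polynomial_function p"
    and "local_min_on UNIV p 0"
    and "p 0 = 0"
    and "local_min_on {x. p x = 0} (\<lambda>x. x $ k) 0"
  shows "local_min_on {x. \<forall>i. partial_deriv p i x = 0} (\<lambda>x. x $ k) 0"
proof -
  define C where "C = {x. \<forall>i. partial_deriv p i x = 0}"
  obtain V where V: "open V" "0 \<in> V" "\<And>y. y \<in> V \<Longrightarrow> p y = 0 \<Longrightarrow> y $ k \<ge> 0"
    using assms(4) by (auto simp: local_min_on_def)
  have "continuous_on UNIV p"
    using assms(1) continuous_on_polymonial_function real_polynomial_function_eq by blast
  \<comment> \<open>Nonzero critical values form a finite set, so staying away from them is an open condition.\<close>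
  moreover have "open (- (p ` C - {0}))"
    using finite_critical_values[OF assms(1)] unfolding C_def
    by (intro open_Compl finite_imp_closed finite_Diff)
  ultimately have "open (p -` (- (p ` C - {0})))"
    by (rule open_vimage[rotated])
  then have "open (V \<inter> p -` (- (p ` C - {0})))" (is "open ?W")
    using V(1) by blast
  moreover have "0 \<in> ?W"
    using V(2) assms(3) by simp
  moreover have "y $ k \<ge> 0" if "y \<in> C \<inter> ?W" for y
    using that V(3) by auto
  moreover have "0 \<in> C"
    using local_min_imp_critical[OF assms(1,2)] by (simp add: C_def)
  ultimately show ?thesis
    unfolding local_min_on_def C_def[symmetric] by (intro conjI exI[of _ ?W]) auto
qed

end
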